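(* Let $f: X \to Y$ be a continuous mapping of topological spaces and $y\in Y$. Let $(\mathcal{O}_{n}, \varphi_{n})$, $n \in \omega_{0}$, be pairs, where $\mathcal{O}_{n}$ is a neighborhood of $y$ and $\varphi_{n}: X\to [0, 1]$ is a function, such that (a) $\mathcal{O}_{n+1}\subset \mathcal{O}_{n}$ for $n\in\omega_0$, and $\mathcal{O}_{0} = Y$; (b) the sequence $\{ \mathrm{osc}_{\varphi_{n}}(f^{-1}\mathcal{O}_{n}) \}_{n \in \mathbb{N}}$ converges to $0$; (c) the number series $\sum_{n=0}^{\infty}\big\|\varphi_{n+1}|_{f^{-1}\mathcal{O}_{n+1}} - \varphi_{n}|_{f^{-1}\mathcal{O}_{n+1}}\big\|$ converges. Then the function $\varphi: X \to [0, 1]$ given by $$\varphi (x) = \begin{cases} \varphi_{n}(x), & x \in f^{-1}\mathcal{O}_{n} \setminus f^{-1}\mathcal{O}_{n+1},\ n \in \omega_{0},\\ \lim\limits_{n \to \infty}\varphi_{n}(x), & x\in\bigcap_{n=0}^{\infty} f^{-1}\mathcal{O}_{n} \end{cases}$$ is $f$-continuous at $y$.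
   Context: Neighborhoods are open. $\mathbb{N}=\{1,2,\dots\}$, $\omega_0=\{0\}\cup\mathbb N$. Functions are real-valued and not necessarily continuous. For a bounded function $\varphi$ on a set, $\|\varphi\|$ is the supremum of $|\varphi|$ over its domain (read as $0$ if the domain is empty). For a bounded $\varphi:X\to\mathbb R$ and $x\in X$, $\mathrm{osc}_\varphi(x)=\inf\{\sup_{z\in U}|\varphi(x)-\varphi(z)| : U \text{ an open neighborhood of } x\}$; for non-empty $A\subset X$, $\mathrm{osc}_\varphi(A)=\sup_{x\in A}\mathrm{osc}_\varphi(x)$, and $\mathrm{osc}_\varphi(\varnothing)=0$. A bounded function $\varphi: X\to\mathbb R$ is $f$-continuous at $y\in Y$ if for any $\varepsilon>0$ there is a neighborhood $\mathcal{O}y$ of $y$ with $\mathrm{osc}_\varphi(f^{-1}\mathcal{O}y)<\varepsilon$. *)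

theory Defs
  imports "HOL-Analysis.Analysis"
begin

abbreviation preimage_in :: "'a topology \<Rightarrow> ('a \<Rightarrow> 'b) \<Rightarrow> 'b set \<Rightarrow> 'a set" where
  "preimage_in X f V \<equiv> {x \<in> topspace X. f x \<in> V}"

text \<open>The real-valued \<open>Sup\<close> and \<open>Inf\<close> below have their intended meaning only for functions
  that are bounded on the relevant set. The case distinctions are needed because \<open>Sup {}\<close> is
  unspecified for reals.\<close>

definition sup_norm_on :: "'a set \<Rightarrow> ('a \<Rightarrow> real) \<Rightarrow> real" where
  "sup_norm_on A g = (if A = {} then 0 else (SUP x\<in>A. \<bar>g x\<bar>))"

definition osc_at :: "'a topology \<Rightarrow> ('a \<Rightarrow> real) \<Rightarrow> 'a \<Rightarrow> real" where
  "osc_at X \<phi> x = (INF U\<in>{U. openin X U \<and> x \<in> U}. SUP z\<in>U. \<bar>\<phi> x - \<phi> z\<bar>)"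

definition osc_on :: "'a topology \<Rightarrow> ('a \<Rightarrow> real) \<Rightarrow> 'a set \<Rightarrow> real" where
  "osc_on X \<phi> A = (if A = {} then 0 else (SUP x\<in>A. osc_at X \<phi> x))"

definition map_continuous_at ::
  "'a topology \<Rightarrow> 'b topology \<Rightarrow> ('a \<Rightarrow> 'b) \<Rightarrow> ('a \<Rightarrow> real) \<Rightarrow> 'b \<Rightarrow> bool" where
  "map_continuous_at X Y f \<phi> y \<longleftrightarrow>
     bounded (\<phi> ` topspace X) \<and>
     (\<forall>\<epsilon>>0. \<exists>V. openin Y V \<and> y \<in> V \<and> osc_on X \<phi> (preimage_in X f V) < \<epsilon>)"

text \<open>The piecewise function of the theorem. For a decreasing sequence \<open>W\<close> the index \<open>n\<close> with
  \<open>x \<in> preimage_in X f (W n) - preimage_in X f (W (Suc n))\<close> is unique if it exists; if also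
  \<open>W 0\<close> is the whole space, it exists for every point of \<open>X\<close> outside the intersection of the
  preimages. Values outside \<open>topspace X\<close> are irrelevant.\<close>

definition glued ::
  "'a topology \<Rightarrow> ('a \<Rightarrow> 'b) \<Rightarrow> (nat \<Rightarrow> 'b set) \<Rightarrow> (nat \<Rightarrow> 'a \<Rightarrow> real) \<Rightarrow> 'a \<Rightarrow> real" where
  "glued X f W \<phi> x =
     (if x \<in> (\<Inter>n. preimage_in X f (W n)) then lim (\<lambda>n. \<phi> n x)
      else \<phi> (THE n. x \<in> preimage_in X f (W n) - preimage_in X f (W (Suc n))) x)"

lemma glued_ring:
  assumes dec: "\<And>n. W (Suc n) \<subseteq> W n"
    and x: "x \<in> preimage_in X f (W n) - preimage_in X f (W (Suc n))"
  shows "glued X f W \<phi> x = \<phi> n x"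
proof -
  have anti: "W j \<subseteq> W i" if "i \<le> j" for i j
    using lift_Suc_antimono_le[of W, OF dec that] .
  have "m = n" if "x \<in> preimage_in X f (W m) - preimage_in X f (W (Suc m))" for m
  proof (rule ccontr)
    assume "m \<noteq> n"
    then have "Suc m \<le> n \<or> Suc n \<le> m" by arith
    then show False using anti[of "Suc m" n] anti[of "Suc n" m] that x by auto
  qed
  then have "(THE n. x \<in> preimage_in X f (W n) - preimage_in X f (W (Suc n))) = n"
    using x by (intro the_equality) auto
  moreover have "x \<notin> (\<Inter>n. preimage_in X f (W n))" using x by blast
  ultimately show ?thesis unfolding glued_def by (simp only: if_False)
qed

lemma glued_Inter:
  "x \<in> (\<Inter>n. preimage_in X f (W n)) \<Longrightarrow> glued X f W \<phi> x = lim (\<lambda>n. \<phi> n x)"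
  unfolding glued_def by simp

lemma glued_cases:
  assumes "x \<in> topspace X" and "f x \<in> W 0"
  shows "x \<in> (\<Inter>n. preimage_in X f (W n)) \<or>
    (\<exists>n. x \<in> preimage_in X f (W n) - preimage_in X f (W (Suc n)))"
proof (rule ccontr)
  assume neg: "\<not> ?thesis"
  have "x \<in> preimage_in X f (W n)" for n
    by (induction n) (use assms neg in auto)
  then show False using neg by blast
qed

end

theory Submission
  imports Defs
begin

text \<open>
  Write \<open>A n\<close> for the preimage of \<open>W n\<close> and \<open>a n\<close> for the supremum of
  \<open>\<bar>\<phi> (Suc n) x - \<phi> n x\<bar>\<close> over \<open>A (Suc n)\<close>. At a point of the ring \<open>A m - A (Suc m)\<close>
  with \<open>N \<le> m\<close> the glued function is \<open>\<phi> m\<close>. Such a point lies in each of \<open>A N, ..., A m\<close>, so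
  there the glued function differs from \<open>\<phi> N\<close> by at most \<open>a N + ... + a (m - 1)\<close>; at a point
  of all the \<open>A n\<close> these bounds for \<open>\<phi> m\<close> pass to the limit. Hence the glued function is within the tail \<open>a N + a (N + 1) + ...\<close> of \<open>\<phi> N\<close>,
  uniformly on \<open>A N\<close> (\<open>glued_dist_le_tail\<close>).

  Oscillation at a point is local and moves by at most twice a uniform perturbation
  (\<open>osc_at_perturb\<close>). As \<open>A N\<close> is open by continuity of \<open>f\<close>, the oscillation of the glued
  function on \<open>A N\<close> is therefore at most that of \<open>\<phi> N\<close> plus twice the tail, and both tend
  to \<open>0\<close> as \<open>N\<close> grows. So \<open>W N\<close> for a large \<open>N\<close> is the neighborhood of \<open>y\<close> that
  \<open>f\<close>-continuity asks for.
\<close>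

lemma abs_le_sup_norm_on:
  assumes "bdd_above ((\<lambda>x. \<bar>g x\<bar>) ` A)" and "x \<in> A"
  shows "\<bar>g x\<bar> \<le> sup_norm_on A g"
  using assms cSUP_upper[of x A "\<lambda>x. \<bar>g x\<bar>"] by (auto simp: sup_norm_on_def)

lemma sup_norm_on_nonneg:
  assumes "bdd_above ((\<lambda>x. \<bar>g x\<bar>) ` A)"
  shows "0 \<le> sup_norm_on A g"
proof (cases "A = {}")
  case False
  then obtain x where "x \<in> A" by blast
  from order_trans[OF abs_ge_zero abs_le_sup_norm_on[OF assms this]] show ?thesis .
qed (simp add: sup_norm_on_def)

lemma bdd_above_abs_diff:
  fixes g :: "'a \<Rightarrow> real"
  assumes "bounded (g ` S)" and "U \<subseteq> S" and "x \<in> S"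
  shows "bdd_above ((\<lambda>z. \<bar>g x - g z\<bar>) ` U)"
proof -
  obtain B where B: "\<And>z. z \<in> S \<Longrightarrow> \<bar>g z\<bar> \<le> B"
    using assms(1) by (auto simp: bounded_iff)
  have "\<bar>g x - g z\<bar> \<le> 2 * B" if "z \<in> U" for z
    using B[of x] B[of z] that assms(2,3) by auto
  then show ?thesis by (auto intro!: bdd_aboveI2)
qed

text \<open>Boundedness makes every supremum over a neighborhood of \<open>x\<close> a genuine one. It is then
  nonnegative because \<open>x\<close> itself contributes \<open>0\<close>, and so \<open>0\<close> bounds the infimum from below.\<close>

lemma osc_at_le_SUP:
  assumes bd: "bounded (g ` topspace X)" and U: "openin X U" "x \<in> U"
  shows "osc_at X g x \<le> (SUP z\<in>U. \<bar>g x - g z\<bar>)"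
  unfolding osc_at_def
proof (rule cINF_lower)
  have "0 \<le> (SUP z\<in>V. \<bar>g x - g z\<bar>)" if "openin X V" "x \<in> V" for V
    using cSUP_upper[OF \<open>x \<in> V\<close> bdd_above_abs_diff[OF bd openin_subset[OF that(1)]]]
      that openin_subset[OF that(1)] by fastforce
  then show "bdd_below ((\<lambda>U. SUP z\<in>U. \<bar>g x - g z\<bar>) ` {U. openin X U \<and> x \<in> U})"
    by (auto intro!: bdd_belowI2[where m = 0])
qed (use U in auto)

text \<open>Since \<open>A\<close> is open, each neighborhood \<open>U\<close> of \<open>x\<close> yields the competitor \<open>U \<inter> A\<close> in the
  infimum that defines the oscillation of \<open>g\<close>. For \<open>z\<close> there,
  \<open>\<bar>g x - g z\<bar>\<close> exceeds \<open>\<bar>h x - h z\<bar>\<close> by at most \<open>\<delta>\<close> for each of the two values replaced.\<close>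

lemma osc_at_perturb:
  assumes bg: "bounded (g ` topspace X)" and bh: "bounded (h ` topspace X)"
    and A: "openin X A" "x \<in> A" and close: "\<And>z. z \<in> A \<Longrightarrow> \<bar>g z - h z\<bar> \<le> \<delta>"
  shows "osc_at X g x \<le> osc_at X h x + 2 * \<delta>"
proof -
  have "osc_at X g x - 2 * \<delta> \<le> (SUP z\<in>U. \<bar>h x - h z\<bar>)" if U: "openin X U" "x \<in> U" for U
  proof -
    have bdd: "bdd_above ((\<lambda>z. \<bar>h x - h z\<bar>) ` U)"
      by (rule bdd_above_abs_diff[OF bh openin_subset[OF U(1)]])
        (use U openin_subset in blast)
    have "osc_at X g x \<le> (SUP z\<in>U \<inter> A. \<bar>g x - g z\<bar>)"
      by (rule osc_at_le_SUP[OF bg]) (use U A in auto)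
    also have "\<dots> \<le> (SUP z\<in>U. \<bar>h x - h z\<bar>) + 2 * \<delta>"
    proof (rule cSUP_least)
      fix z assume z: "z \<in> U \<inter> A"
      then have "\<bar>h x - h z\<bar> \<le> (SUP z\<in>U. \<bar>h x - h z\<bar>)"
        by (intro cSUP_upper[OF _ bdd]) auto
      then show "\<bar>g x - g z\<bar> \<le> (SUP z\<in>U. \<bar>h x - h z\<bar>) + 2 * \<delta>"
        using close[of x] close[of z] z A(2) by auto
    qed (use U A in auto)
    finally show ?thesis by simp
  qed
  then have "osc_at X g x - 2 * \<delta> \<le> osc_at X h x"
    unfolding osc_at_def[of X h]
    by (intro cINF_greatest) (use A in auto)
  then show ?thesis by simp
qed

lemma osc_at_le_osc_on:
  assumes bd: "bounded (g ` topspace X)" and A: "A \<subseteq> topspace X" "x \<in> A"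
  shows "osc_at X g x \<le> osc_on X g A"
proof -
  obtain B where B: "\<And>z. z \<in> topspace X \<Longrightarrow> \<bar>g z\<bar> \<le> B"
    using bd by (auto simp: bounded_iff)
  have "osc_at X g z \<le> 2 * B" if z: "z \<in> A" for z
  proof -
    have "osc_at X g z \<le> (SUP w\<in>topspace X. \<bar>g z - g w\<bar>)"
      by (rule osc_at_le_SUP[OF bd]) (use A z in auto)
    also have "\<dots> \<le> 2 * B"
    proof (rule cSUP_least)
      fix w assume "w \<in> topspace X"
      then show "\<bar>g z - g w\<bar> \<le> 2 * B" using B[of z] B[of w] A(1) z by auto
    qed (use A z in auto)
    finally show ?thesis .
  qed
  then have "bdd_above (osc_at X g ` A)" by (auto intro!: bdd_aboveI2)
  then show ?thesis using A cSUP_upper[of x A "osc_at X g"] by (auto simp: osc_on_def)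
qed

lemma osc_on_perturb:
  assumes bg: "bounded (g ` topspace X)" and bh: "bounded (h ` topspace X)"
    and A: "openin X A" and close: "\<And>z. z \<in> A \<Longrightarrow> \<bar>g z - h z\<bar> \<le> \<delta>" and "0 \<le> \<delta>"
  shows "osc_on X g A \<le> osc_on X h A + 2 * \<delta>"
proof (cases "A = {}")
  case False
  have "osc_at X g x \<le> osc_on X h A + 2 * \<delta>" if "x \<in> A" for x
    using osc_at_perturb[OF bg bh A that close]
      osc_at_le_osc_on[OF bh openin_subset[OF A] that] by linarith
  then have "(SUP x\<in>A. osc_at X g x) \<le> osc_on X h A + 2 * \<delta>"
    using False by (intro cSUP_least) auto
  then show ?thesis using False by (simp add: osc_on_def[of X g])
qed (use \<open>0 \<le> \<delta>\<close> in \<open>simp add: osc_on_def\<close>)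

lemma abs_diff_le_summable_tail:
  fixes u a :: "nat \<Rightarrow> real"
  assumes sm: "summable a" and nn: "\<And>k. 0 \<le> a k" and "N \<le> m"
    and step: "\<And>k. N \<le> k \<Longrightarrow> k < m \<Longrightarrow> \<bar>u (Suc k) - u k\<bar> \<le> a k"
  shows "\<bar>u m - u N\<bar> \<le> (\<Sum>k. a (k + N))"
proof -
  have "u m - u N = (\<Sum>k=N..<m. u (Suc k) - u k)"
    using sum_Suc_diff'[OF \<open>N \<le> m\<close>, of u] by simp
  also have "\<bar>\<dots>\<bar> \<le> (\<Sum>k=N..<m. a k)"
    by (rule order_trans[OF sum_abs sum_mono]) (use step in auto)
  also have "\<dots> = (\<Sum>k<m - N. a (k + N))"
    using sum.shift_bounds_nat_ivl[of a 0 N "m - N"] \<open>N \<le> m\<close> by (simp add: atLeast0LessThan)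
  also have "\<dots> \<le> (\<Sum>k. a (k + N))"
    by (rule sum_le_suminf) (use sm nn in \<open>auto simp: summable_iff_shift\<close>)
  finally show ?thesis .
qed

lemma convergent_of_summable_steps:
  fixes u a :: "nat \<Rightarrow> real"
  assumes "summable a" and step: "\<And>k. \<bar>u (Suc k) - u k\<bar> \<le> a k"
  shows "convergent u"
proof -
  have "summable (\<lambda>k. u (Suc k) - u k)"
    by (rule summable_comparison_test'[OF assms(1)]) (use step in simp)
  then have "convergent (\<lambda>n. (\<Sum>k<n. u (Suc k) - u k) + u 0)"
    by (intro convergent_add convergent_const) (simp add: summable_iff_convergent)
  then show ?thesis by (simp add: sum_lessThan_telescope)
qed

text \<open>In a ring of index \<open>m\<close> only the steps from \<open>N\<close> to \<open>m\<close> are controlled, and only these are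
  used. On the intersection of the preimages the same bound holds for every \<open>\<phi> m\<close> with
  \<open>N \<le> m\<close> and passes to the limit.\<close>

lemma glued_dist_le_tail:
  assumes dec: "\<And>n. W (Suc n) \<subseteq> W n" and sm: "summable a" and nn: "\<And>k. 0 \<le> a k"
    and step: "\<And>k x. x \<in> preimage_in X f (W (Suc k)) \<Longrightarrow> \<bar>\<phi> (Suc k) x - \<phi> k x\<bar> \<le> a k"
    and x: "x \<in> preimage_in X f (W N)"
  shows "\<bar>glued X f W \<phi> x - \<phi> N x\<bar> \<le> (\<Sum>k. a (k + N))"
proof -
  have anti: "W j \<subseteq> W i" if "i \<le> j" for i j
    using lift_Suc_antimono_le[of W, OF dec that] .
  have dist: "\<bar>\<phi> m x - \<phi> N x\<bar> \<le> (\<Sum>k. a (k + N))"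
    if "N \<le> m" and m: "x \<in> preimage_in X f (W m)" for m
  proof (rule abs_diff_le_summable_tail[OF sm nn \<open>N \<le> m\<close>])
    fix k assume "k < m"
    then show "\<bar>\<phi> (Suc k) x - \<phi> k x\<bar> \<le> a k"
      using anti[of "Suc k" m] m by (intro step) auto
  qed
  have "x \<in> topspace X" "f x \<in> W 0" using x anti[of 0 N] by auto
  from glued_cases[where f = f and W = W, OF this] consider
      (all) "x \<in> (\<Inter>n. preimage_in X f (W n))"
    | (ring) m where "x \<in> preimage_in X f (W m) - preimage_in X f (W (Suc m))"
    by blast
  then show ?thesis
  proof cases
    case all
    have "convergent (\<lambda>n. \<phi> n x)"
      by (rule convergent_of_summable_steps[OF sm]) (use all in \<open>blast intro: step\<close>)
    then have "(\<lambda>n. \<phi> n x) \<longlonglongrightarrow> glued X f W \<phi> x"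
      by (simp only: glued_Inter[OF all] convergent_LIMSEQ_iff)
    then have "(\<lambda>n. \<bar>\<phi> n x - \<phi> N x\<bar>) \<longlonglongrightarrow> \<bar>glued X f W \<phi> x - \<phi> N x\<bar>"
      by (intro tendsto_intros)
    then show ?thesis
      by (rule LIMSEQ_le_const2) (use all dist in blast)
  next
    case ring
    have "N \<le> m"
    proof (rule ccontr)
      assume "\<not> N \<le> m"
      then show False using anti[of "Suc m" N] x ring by auto
    qed
    then show ?thesis using glued_ring[OF dec ring] dist ring by simp
  qed
qed

lemma suminf_tail_tendsto_0:
  fixes a :: "nat \<Rightarrow> real"
  assumes "summable a"
  shows "(\<lambda>N. \<Sum>k. a (k + N)) \<longlonglongrightarrow> 0"
proof -
  have "(\<lambda>N. suminf a - (\<Sum>k<N. a k)) \<longlonglongrightarrow> suminf a - suminf a"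
    by (intro tendsto_intros summable_LIMSEQ assms)
  then show ?thesis by (simp add: suminf_minus_initial_segment[OF assms])
qed

theorem lemma2p1:
  fixes X :: "'a topology" and Y :: "'b topology"
    and f :: "'a \<Rightarrow> 'b" and y :: 'b
    and W :: "nat \<Rightarrow> 'b set" and \<phi> :: "nat \<Rightarrow> 'a \<Rightarrow> real"
  assumes "continuous_map X Y f"
    and "y \<in> topspace Y"
    and "\<And>n. openin Y (W n)" and "\<And>n. y \<in> W n"
    and "\<And>n. \<phi> n \<in> topspace X \<rightarrow> {0..1}"
    and "\<And>n. W (Suc n) \<subseteq> W n" and "W 0 = topspace Y"
    and "(\<lambda>n. osc_on X (\<phi> (Suc n)) (preimage_in X f (W (Suc n)))) \<longlonglongrightarrow> 0"
    and "summable (\<lambda>n. sup_norm_on (preimage_in X f (W (Suc n)))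
                         (\<lambda>x. \<phi> (Suc n) x - \<phi> n x))"
  shows "(\<forall>x \<in> (\<Inter>n. preimage_in X f (W n)). convergent (\<lambda>n. \<phi> n x)) \<and>
    glued X f W \<phi> \<in> topspace X \<rightarrow> {0..1} \<and>
    map_continuous_at X Y f (glued X f W \<phi>) y"
proof -
  let ?A = "\<lambda>n. preimage_in X f (W n)"
  let ?g = "glued X f W \<phi>"
  define a where "a n = sup_norm_on (?A (Suc n)) (\<lambda>x. \<phi> (Suc n) x - \<phi> n x)" for n
  define T where "T N = (\<Sum>k. a (k + N))" for N
  note dec = assms(6)
  have sm: "summable a" using assms(9) by (simp add: a_def[abs_def])
  have rng: "0 \<le> \<phi> n x \<and> \<phi> n x \<le> 1" if "x \<in> topspace X" for n x
    using assms(5)[of n] that by auto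
  have bdd: "bdd_above ((\<lambda>x. \<bar>\<phi> (Suc n) x - \<phi> n x\<bar>) ` ?A (Suc n))" for n
  proof (rule bdd_aboveI2)
    fix x assume "x \<in> ?A (Suc n)"
    then show "\<bar>\<phi> (Suc n) x - \<phi> n x\<bar> \<le> 1"
      using rng[of x n] rng[of x "Suc n"] by auto
  qed
  have nn: "0 \<le> a n" for n unfolding a_def by (rule sup_norm_on_nonneg[OF bdd])
  have step: "\<bar>\<phi> (Suc n) x - \<phi> n x\<bar> \<le> a n" if "x \<in> ?A (Suc n)" for n x
    unfolding a_def using abs_le_sup_norm_on[OF bdd that] .
  have conv: "convergent (\<lambda>n. \<phi> n x)" if "x \<in> (\<Inter>n. ?A n)" for x
    by (rule convergent_of_summable_steps[OF sm]) (use that in \<open>blast intro: step\<close>)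

  have grng: "?g x \<in> {0..1}" if x: "x \<in> topspace X" for x
  proof -
    have "f x \<in> W 0"
      using assms(1,7) x by (auto simp: continuous_map_def)
    from glued_cases[where f = f and W = W, OF x this] show ?thesis
    proof
      assume all: "x \<in> (\<Inter>n. ?A n)"
      have "(\<lambda>n. \<phi> n x) \<longlonglongrightarrow> ?g x"
        using conv[OF all] by (simp only: glued_Inter[OF all] convergent_LIMSEQ_iff)
      then show ?thesis
        by (rule closed_sequentially[OF closed_atLeastAtMost, rotated]) (use rng x in auto)
    next
      assume "\<exists>n. x \<in> ?A n - ?A (Suc n)"
      then obtain n where "x \<in> ?A n - ?A (Suc n)" by blast
      from glued_ring[OF dec this, of \<phi>] show ?thesis using rng[OF x] by simp
    qed
  qed
  have bounded_01: "bounded (h ` topspace X)" if "h \<in> topspace X \<rightarrow> {0..1}"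
    for h :: "'a \<Rightarrow> real"
    by (rule bounded_subset[OF bounded_closed_interval]) (use that in auto)
  have bg: "bounded (?g ` topspace X)" using grng by (intro bounded_01) blast

  have osc: "osc_on X ?g (?A n) \<le> osc_on X (\<phi> n) (?A n) + 2 * T n" for n
    unfolding T_def
  proof (rule osc_on_perturb[OF bg bounded_01[OF assms(5)]])
    show "openin X (?A n)" using openin_continuous_map_preimage[OF assms(1) assms(3)] .
    show "\<bar>?g z - \<phi> n z\<bar> \<le> (\<Sum>k. a (k + n))" if "z \<in> ?A n" for z
      by (rule glued_dist_le_tail[OF dec sm nn step that])
    show "0 \<le> (\<Sum>k. a (k + n))"
      by (rule suminf_nonneg) (use sm nn in \<open>auto simp: summable_iff_shift\<close>)
  qed
  have "(\<lambda>n. osc_on X (\<phi> (Suc n)) (?A (Suc n)) + 2 * T (Suc n)) \<longlonglongrightarrow> 0 + 2 * 0"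
    unfolding T_def
    by (intro tendsto_intros assms(8) LIMSEQ_Suc[OF suminf_tail_tendsto_0[OF sm]])
  then have lim: "(\<lambda>n. osc_on X (\<phi> (Suc n)) (?A (Suc n)) + 2 * T (Suc n)) \<longlonglongrightarrow> 0"
    by simp
  have "\<exists>V. openin Y V \<and> y \<in> V \<and> osc_on X ?g (preimage_in X f V) < \<epsilon>" if "0 < \<epsilon>" for \<epsilon>
  proof -
    obtain n where "osc_on X (\<phi> (Suc n)) (?A (Suc n)) + 2 * T (Suc n) < \<epsilon>"
      using order_tendstoD(2)[OF lim \<open>0 < \<epsilon>\<close>] by (auto simp: eventually_sequentially)
    then have "osc_on X ?g (?A (Suc n)) < \<epsilon>" using osc[of "Suc n"] by linarith
    then show ?thesis using assms(3,4) by blast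
  qed
  then show ?thesis
    using conv grng bg unfolding map_continuous_at_def by blast
qed

end
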